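(* Let $p\ge 1$ and $q\ge 0$ be integers, and let $P(z)=\sum_{i=0}^{p}a_i z^{-i}$ and $Q(z)=\sum_{i=0}^{q}b_i z^{-i}$ with complex coefficients, $a_p\neq 0$, $b_q\neq 0$, $a_0=b_0=1$ and $a_1=b_1$ (with $b_1:=0$ if $q=0$). Let $r_1,\dots,r_p$ be the roots of $P$ and $s_1,\dots,s_q$ the roots of $Q$ in $\mathbb{C}\setminus\{0\}$, listed with multiplicity (not necessarily different). Suppose that $r_1=k$, where $k$ is a positive integer, and that none of $r_2,\dots,r_p,s_1,\dots,s_q$ is a positive integer. Then $$\prod_{n=1,\;n\neq k}^{\infty}\frac{P(n)}{Q(n)}=(-1)^{k-1}\,k^{p-q}\,(k-1)!\;\frac{\prod_{i=1}^{q}(k-s_i)\,\Gamma(1-s_i)}{\prod_{i=2}^{p}(k-r_i)\,\Gamma(1-r_i)} .$$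
   Context: $\Gamma$ denotes the Euler gamma function. $P$ and $Q$ are polynomials in $1/z$ with constant term $1$, so $P(z)=\prod_{i=1}^{p}(1-r_i/z)$ and $Q(z)=\prod_{i=1}^{q}(1-s_i/z)$. Empty products equal $1$. The infinite product is the limit as $N\to\infty$ of the product over $1\le n\le N$, $n\ne k$. *)

theory Defs
  imports "HOL-Complex_Analysis.Complex_Analysis"
begin

definition inv_polynomial :: "(nat \<Rightarrow> complex) \<Rightarrow> nat \<Rightarrow> complex \<Rightarrow> complex" where
  "inv_polynomial a p z = (\<Sum>i=0..p. a i * z powi (- int i))"

text \<open>The family \<open>r 1, \<dots>, r m\<close> lists the roots of \<open>f\<close> in the punctured plane with multiplicity.
  The multiplicity of \<open>f\<close> at \<open>z\<close> is the order of vanishing there (\<^const>\<open>zorder\<close>), which is \<open>0\<close>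
  where the holomorphic function \<open>f\<close> does not vanish, so every root occurs and nothing else does.\<close>

definition lists_nonzero_roots :: "(complex \<Rightarrow> complex) \<Rightarrow> nat \<Rightarrow> (nat \<Rightarrow> complex) \<Rightarrow> bool" where
  "lists_nonzero_roots f m r \<longleftrightarrow>
     (\<forall>i\<in>{1..m}. r i \<noteq> 0) \<and>
     (\<forall>z. z \<noteq> 0 \<longrightarrow> int (card {i\<in>{1..m}. r i = z}) = zorder f z)"

end

theory Submission
  imports Defs "HOL-Computational_Algebra.Fundamental_Theorem_Algebra"
begin

text \<open>
  Clearing denominators factors \<open>P(n)\<close> as the product of the \<open>1 - r\<^sub>i/n\<close>, and likewise \<open>Q(n)\<close>.
  A single factor \<open>1 - r/n\<close>, multiplied over \<open>n \<le> N\<close>, behaves like \<open>N\<^bsup>-r\<^esup> / \<Gamma>(1 - r)\<close>,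
  and removing \<open>n = k\<close> contributes \<open>k / (k - r)\<close>; for \<open>r = k\<close> the product with \<open>n = k\<close> removed is
  a signed reciprocal binomial coefficient. Since \<open>a\<^sub>1 = b\<^sub>1\<close>, the \<open>r\<^sub>i\<close> and the \<open>s\<^sub>i\<close> have the same
  sum, so the powers of \<open>N\<close> cancel in the quotient.
\<close>

section \<open>Factorisation over the listed roots\<close>

text \<open>Reversing the coefficients gives a genuine polynomial, to which algebraic root orders
  and the fundamental theorem of algebra apply.\<close>

definition recip_poly :: "(nat \<Rightarrow> complex) \<Rightarrow> nat \<Rightarrow> complex poly" where
  "recip_poly a p = (\<Sum>i\<le>p. monom (a i) (p - i))"

lemma poly_recip_poly:
  assumes "z \<noteq> 0"
  shows "poly (recip_poly a p) z = z ^ p * inv_polynomial a p z"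
proof -
  have "z ^ (p - i) = z ^ p * z powi (- int i)" if "i \<le> p" for i
    using that assms by (simp add: power_int_minus power_diff divide_inverse)
  then show ?thesis
    unfolding recip_poly_def inv_polynomial_def
    by (simp add: poly_sum poly_monom sum_distrib_left mult_ac atMost_atLeast0)
qed

lemma coeff_recip_poly:
  assumes "j \<le> p"
  shows "coeff (recip_poly a p) (p - j) = a j"
proof -
  have "coeff (recip_poly a p) (p - j) = (\<Sum>i\<le>p. if i = j then a i else 0)"
    unfolding recip_poly_def coeff_sum
    by (rule sum.cong) (use assms in auto)
  with assms show ?thesis by simp
qed

lemma degree_recip_poly_le: "degree (recip_poly a p) \<le> p"
  unfolding recip_poly_def
  by (intro degree_sum_le) (auto intro: order.trans[OF degree_monom_le])

text \<open>Away from 0 the factor \<open>z ^ p\<close> is holomorphic without zeros, so it leaves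
  orders unchanged. This turns the analytic multiplicity in \<open>lists_nonzero_roots\<close> into
  the algebraic \<open>order\<close>.\<close>

lemma zorder_inv_polynomial:
  assumes "z \<noteq> 0" "recip_poly a p \<noteq> 0"
  shows "zorder (inv_polynomial a p) z = int (order z (recip_poly a p))"
proof -
  obtain B where B: "recip_poly a p = [:- z, 1:] ^ order z (recip_poly a p) * B"
    "\<not> [:- z, 1:] dvd B"
    using order_decomp[OF assms(2)] by blast
  \<comment> \<open>The cofactor \<open>B\<close> divided by \<open>w ^ p\<close> is the
    nonvanishing part: \<open>B\<close> is nonzero at \<open>z\<close> because
    \<open>[:- z, 1:]\<close> does not divide it.\<close>
  show ?thesis
  proof (rule zorder_eqI[where S = "- {0}" and g = "\<lambda>w. poly B w / w ^ p"])
    show "poly B z / z ^ p \<noteq> 0"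
      using B(2) assms by (simp add: poly_eq_0_iff_dvd)
    fix w :: complex assume w: "w \<in> - {0}"
    have "poly (recip_poly a p) w = (w - z) ^ order z (recip_poly a p) * poly B w"
      by (subst B(1)) (simp add: poly_power)
    with w show "inv_polynomial a p w =
        poly B w / w ^ p * (w - z) powi int (order z (recip_poly a p))"
      by (simp add: poly_recip_poly field_simps)
  qed (use assms in \<open>auto intro!: holomorphic_intros\<close>)
qed

text \<open>Grouping the indices by the value of \<open>r\<close> collects exactly
  \<open>order z A\<close> copies of each linear factor, which is the decomposition of a monic
  complex polynomial.\<close>

lemma monic_poly_eq_prod_linear:
  fixes r :: "nat \<Rightarrow> complex"
  assumes "finite I" "A \<noteq> 0" "lead_coeff A = 1"
    and ord: "\<And>z. card {i\<in>I. r i = z} = order z A"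
  shows "A = (\<Prod>i\<in>I. [:- r i, 1:])"
proof -
  have "r ` I \<subseteq> {z. poly A z = 0}"
  proof safe
    fix i assume "i \<in> I"
    with \<open>finite I\<close> have "card {j\<in>I. r j = r i} \<noteq> 0" by auto
    with ord \<open>A \<noteq> 0\<close> show "poly A (r i) = 0" by (simp add: order_root)
  qed
  then have "(\<Prod>z | poly A z = 0. \<Prod>i | i \<in> I \<and> r i = z. [:- r i, 1:]) = (\<Prod>i\<in>I. [:- r i, 1:])"
    using assms by (intro prod.group) (auto simp: poly_roots_finite)
  moreover have "(\<Prod>i | i \<in> I \<and> r i = z. [:- r i, 1:]) = [:- z, 1:] ^ order z A" for z
  proof -
    have "(\<Prod>i | i \<in> I \<and> r i = z. [:- r i, 1:]) = (\<Prod>i | i \<in> I \<and> r i = z. [:- z, 1:])"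
      by (intro prod.cong) auto
    then show ?thesis by (simp add: ord)
  qed
  ultimately show ?thesis
    using complex_poly_decompose[of A] assms(3) by simp
qed

text \<open>The condition \<open>a 0 = 1\<close> makes the polynomial monic of degree
  \<open>p\<close>, and \<open>a p \<noteq> 0\<close> keeps 0 from being a root. The latter settles
  the one point at which \<open>lists_nonzero_roots\<close> says nothing about orders.\<close>

lemma recip_poly_factor:
  assumes "a 0 = 1" "a p \<noteq> 0" "lists_nonzero_roots (inv_polynomial a p) p r"
  shows "recip_poly a p = (\<Prod>i=1..p. [:- r i, 1:])"
proof (rule monic_poly_eq_prod_linear)
  have c: "coeff (recip_poly a p) p = 1"
    using coeff_recip_poly[of 0 p a] assms by simp
  then show nz: "recip_poly a p \<noteq> 0" by auto
  have "p \<le> degree (recip_poly a p)"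
    by (rule le_degree) (simp add: c)
  with degree_recip_poly_le[of a p] have "degree (recip_poly a p) = p" by simp
  with c show "lead_coeff (recip_poly a p) = 1" by simp
  fix z
  show "card {i \<in> {1..p}. r i = z} = order z (recip_poly a p)"
  proof (cases "z = 0")
    case True
    have "poly (recip_poly a p) 0 \<noteq> 0"
      using coeff_recip_poly[of p p a] assms by (simp add: poly_0_coeff_0)
    then have "order 0 (recip_poly a p) = 0" by (rule order_0I)
    moreover have "{i \<in> {1..p}. r i = 0} = {}"
      using assms(3) by (auto simp: lists_nonzero_roots_def)
    ultimately show ?thesis using True by simp
  next
    case False
    then have "int (card {i \<in> {1..p}. r i = z}) = int (order z (recip_poly a p))"
      using assms(3) zorder_inv_polynomial[OF False nz]
      by (metis (no_types, lifting) lists_nonzero_roots_def)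
    then show ?thesis by simp
  qed
qed simp

lemma inv_polynomial_factor:
  assumes "a 0 = 1" "a p \<noteq> 0" "lists_nonzero_roots (inv_polynomial a p) p r" "z \<noteq> 0"
  shows "inv_polynomial a p z = (\<Prod>i=1..p. (z - r i) / z)"
  using poly_recip_poly[of z a p] assms recip_poly_factor[OF assms(1-3)]
  by (simp add: poly_prod prod_dividef field_simps)

section \<open>Vieta's formula for the sum of the roots\<close>

lemma subleading_coeff_prod_linear:
  fixes r :: "nat \<Rightarrow> 'a :: comm_ring_1"
  shows "coeff (\<Prod>i=1..Suc n. [:- r i, 1:]) n = - (\<Sum>i=1..Suc n. r i)"
proof -
  \<comment> \<open>The vanishing of higher coefficients gives the leading coefficient 1, which is
    what multiplies the new root in the final induction.\<close>
  have zero: "coeff (\<Prod>i=1..n. [:- r i, 1:]) j = 0" if "j > n" for j n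
    using that
  proof (induction n arbitrary: j)
    case (Suc n)
    then show ?case by (cases j) (auto simp: mult.commute[of _ "[:_, 1:]"])
  qed auto
  have one: "coeff (\<Prod>i=1..n. [:- r i, 1:]) n = 1" for n
    by (induction n) (use zero in \<open>auto simp: mult.commute[of _ "[:_, 1:]"]\<close>)
  show ?thesis
  proof (induction n)
    case (Suc n)
    have "coeff (\<Prod>i=1..Suc (Suc n). [:- r i, 1:]) (Suc n) =
        coeff ([:- r (Suc (Suc n)), 1:] * (\<Prod>i=1..Suc n. [:- r i, 1:])) (Suc n)"
      by (subst prod.nat_ivl_Suc') (simp_all only: mult.commute le_add1 Suc_eq_plus1 le_add2)
    also have "\<dots> = coeff (\<Prod>i=1..Suc n. [:- r i, 1:]) n -
        r (Suc (Suc n)) * coeff (\<Prod>i=1..Suc n. [:- r i, 1:]) (Suc n)"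
      by simp
    finally show ?case unfolding one Suc by simp
  qed simp
qed

text \<open>Comparing subleading coefficients in the factorisation gives the sum. For
  \<open>p = 0\<close> there is no such coefficient, and the value 0 of the empty sum matches the
  convention for \<open>b 1\<close> in the theorem.\<close>

lemma sum_roots:
  assumes "a 0 = 1" "a p \<noteq> 0" "lists_nonzero_roots (inv_polynomial a p) p r"
  shows "(\<Sum>i=1..p. r i) = (if p = 0 then 0 else - a 1)"
proof (cases p)
  case (Suc m)
  have "- (\<Sum>i=1..p. r i) = coeff (recip_poly a p) m"
    using subleading_coeff_prod_linear[of r m] recip_poly_factor[OF assms] Suc by (metis minus_minus)
  also have "\<dots> = a 1"
    using coeff_recip_poly[of 1 p a] Suc by simp
  finally have "(\<Sum>i=1..p. r i) = - a 1" by (metis minus_minus)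
  then show ?thesis using Suc by simp
qed simp

section \<open>Limits for a single root\<close>

text \<open>The product is \<open>pochhammer (1 - r) N / fact N\<close>. Euler's limit for the
  reciprocal Gamma function at \<open>1 - r\<close> has one more Pochhammer factor and one more
  power of \<open>N\<close>; the ratio \<open>N / (N + 1 - r)\<close>, which tends to 1, removes
  both.\<close>

lemma tendsto_prod_rGamma:
  fixes r :: complex
  shows "(\<lambda>N. (\<Prod>n=1..N. (of_nat n - r) / of_nat n) * exp (r * of_real (ln (real N))))
    \<longlonglongrightarrow> rGamma (1 - r)"
proof -
  have *: "(\<Prod>n=1..N. (of_nat n - r) / of_nat n) = pochhammer (1 - r) N / fact N" for N
  proof (induction N)
    case (Suc N)
    have "(\<Prod>n=1..Suc N. (of_nat n - r) / of_nat n) =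
        pochhammer (1 - r) N / fact N * ((1 - r + of_nat N) / of_nat (Suc N))"
      using Suc by (simp add: diff_add_eq)
    then show ?case by (simp add: pochhammer_Suc mult.commute)
  qed simp
  have l: "(\<lambda>N. of_nat N / (of_nat N + (1 - r))) \<longlonglongrightarrow> 1"
  proof (rule Lim_transform_eventually)
    show "(\<lambda>N. inverse (1 + (1 - r) * inverse (of_nat N))) \<longlonglongrightarrow> 1"
      by (rule tendsto_eq_intros lim_inverse_n refl | simp)+
    show "\<forall>\<^sub>F N in sequentially. inverse (1 + (1 - r) * inverse (of_nat N)) =
        of_nat N / (of_nat N + (1 - r))"
      using eventually_gt_at_top[of 0] by eventually_elim (simp add: field_simps)
  qed
  have "(\<lambda>N. rGamma_series (1 - r) N * (of_nat N / (of_nat N + (1 - r)))) \<longlonglongrightarrow> rGamma (1 - r)"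
    using tendsto_mult[OF rGamma_series_LIMSEQ l] by simp
  moreover have "\<forall>\<^sub>F N in sequentially. rGamma_series (1 - r) N * (of_nat N / (of_nat N + (1 - r)))
     = (\<Prod>n=1..N. (of_nat n - r) / of_nat n) * exp (r * of_real (ln (real N)))"
  proof -
    \<comment> \<open>A zero denominator would give the ratio the value 0 by the convention for
      division, which the limit 1 excludes for large \<open>N\<close>.\<close>
    have "\<forall>\<^sub>F N in sequentially. of_nat N + (1 - r) \<noteq> 0"
      using tendsto_imp_eventually_ne[OF l, of 0] by (auto elim: eventually_mono)
    then show ?thesis using eventually_gt_at_top[of 0]
    proof eventually_elim
      case (elim N)
      have e: "exp ((1 - r) * of_real (ln (real N))) = of_nat N / exp (r * of_real (ln (real N)))"
        using elim by (simp add: left_diff_distrib exp_diff exp_of_real)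
      define D where "D = of_nat N + (1 - r)"
      have "pochhammer (1 - r) (N + 1) = D * pochhammer (1 - r) N"
        by (simp add: D_def pochhammer_Suc add_ac mult.commute)
      with elim show ?case
        unfolding * rGamma_series_def e D_def[symmetric] by simp
    qed
  qed
  ultimately show ?thesis by (rule Lim_transform_eventually)
qed

lemma prod_remove_nat:
  fixes f :: "nat \<Rightarrow> 'a :: field"
  assumes "k \<ge> 1" "N \<ge> k" "f k \<noteq> 0"
  shows "(\<Prod>n\<in>{1..N} - {k}. f n) = (\<Prod>n=1..N. f n) / f k"
proof -
  have "(\<Prod>n=1..N. f n) = f k * (\<Prod>n\<in>{1..N} - {k}. f n)"
    using assms by (intro prod.remove) auto
  with assms(3) show ?thesis by simp
qed

lemma tendsto_prod_except_rGamma: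
  fixes r :: complex
  assumes "k \<ge> 1" "r \<noteq> of_nat k"
  shows "(\<lambda>N. (\<Prod>n\<in>{1..N} - {k}. (of_nat n - r) / of_nat n) * exp (r * of_real (ln (real N))))
    \<longlonglongrightarrow> of_nat k / (of_nat k - r) * rGamma (1 - r)"
proof (rule Lim_transform_eventually)
  show "(\<lambda>N. of_nat k / (of_nat k - r) * ((\<Prod>n=1..N. (of_nat n - r) / of_nat n) * exp (r * of_real (ln (real N)))))
    \<longlonglongrightarrow> of_nat k / (of_nat k - r) * rGamma (1 - r)"
    by (intro tendsto_mult_left tendsto_prod_rGamma)
  show "\<forall>\<^sub>F N in sequentially. of_nat k / (of_nat k - r) * ((\<Prod>n=1..N. (of_nat n - r) / of_nat n) * exp (r * of_real (ln (real N)))) =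
     (\<Prod>n\<in>{1..N} - {k}. (of_nat n - r) / of_nat n) * exp (r * of_real (ln (real N)))"
    using eventually_ge_at_top[of k]
  proof eventually_elim
    case (elim N)
    then show ?case using assms
      by (subst prod_remove_nat) (auto simp: field_simps)
  qed
qed

section \<open>The exceptional root k\<close>

text \<open>The indices below \<open>k\<close> contribute only the sign, since the numerators
  \<open>-(k - m)\<close> permute the denominators up to sign. The indices from \<open>k + 1\<close>
  to \<open>k + n\<close> give the reciprocal binomial coefficient, so the induction on
  \<open>n\<close> starts from the sign alone.\<close>

lemma prod_except_of_nat:
  assumes "k \<ge> 1"
  shows "(\<Prod>m\<in>{1..n + k} - {k}. (of_nat m - of_nat k) / of_nat m) =
    ((- 1) ^ (k - 1) / of_nat ((k + n) choose n) :: 'a :: field_char_0)"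
proof (induction n)
  case 0
  have "{1..0 + k} - {k} = {1..<k}" by auto
  moreover have "(\<Prod>m=1..<k. of_nat m - of_nat k) = (- 1) ^ (k - 1) * (\<Prod>m=1..<k. of_nat m :: 'a)"
  proof -
    have "(\<Prod>m=1..<k. of_nat m - of_nat k :: 'a) = (\<Prod>m=1..<k. (- 1) * of_nat (k - m))"
      by (intro prod.cong) (auto simp: of_nat_diff)
    also have "\<dots> = (- 1) ^ (k - 1) * (\<Prod>m=1..<k. of_nat (k - m))"
      by (subst prod.distrib) simp
    also have "(\<Prod>m=1..<k. of_nat (k - m) :: 'a) = (\<Prod>m=1..<k. of_nat m)"
      by (rule prod.reindex_bij_witness[of _ "\<lambda>m. k - m" "\<lambda>m. k - m"]) auto
    finally show ?thesis .
  qed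
  ultimately show ?case by (simp add: prod_dividef)
next
  case (Suc n)
  have "{1..Suc n + k} - {k} = insert (Suc n + k) ({1..n + k} - {k})" using assms by auto
  then have "(\<Prod>m\<in>{1..Suc n + k} - {k}. (of_nat m - of_nat k) / of_nat m :: 'a) =
      of_nat (Suc n) / of_nat (Suc (n + k)) * ((- 1) ^ (k - 1) / of_nat ((k + n) choose n))"
    using Suc by simp
  also have "\<dots> = (- 1) ^ (k - 1) / of_nat ((k + Suc n) choose Suc n)"
  proof -
    \<comment> \<open>The absorption identity turns the new factor
      \<open>(n + 1) / (n + 1 + k)\<close> into the change of the binomial coefficient.\<close>
    have "Suc n * ((k + Suc n) choose Suc n) = Suc (n + k) * ((k + n) choose n)"
      using Suc_times_binomial[of n "k + n"] by (simp add: add.commute)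
    then have "(of_nat (Suc n) * of_nat ((k + Suc n) choose Suc n) :: 'a) =
        of_nat (Suc (n + k)) * of_nat ((k + n) choose n)"
      by (metis of_nat_mult)
    moreover have "of_nat ((k + Suc n) choose Suc n) \<noteq> (0 :: 'a)"
      "of_nat ((k + n) choose n) \<noteq> (0 :: 'a)" "of_nat (Suc (n + k)) \<noteq> (0 :: 'a)"
      by (auto simp del: of_nat_Suc binomial_Suc_Suc simp: binomial_eq_0_iff)
    ultimately show ?thesis by (simp add: divide_simps del: of_nat_Suc binomial_Suc_Suc add_Suc_right)
  qed
  finally show ?case .
qed

text \<open>With \<open>N = n + k\<close>, the binomial coefficient grows like
  \<open>n ^ k / fact k\<close>, while the exponential equals \<open>(n + k) ^ k\<close>; the
  quotient of these powers tends to 1, which leaves \<open>fact k\<close> and the sign.\<close>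

lemma tendsto_prod_except_of_nat:
  assumes "k \<ge> 1"
  shows "(\<lambda>N. (\<Prod>n\<in>{1..N} - {k}. (of_nat n - of_nat k) / of_nat n) * exp (of_nat k * of_real (ln (real N))))
    \<longlonglongrightarrow> ((- 1) ^ (k - 1) * fact k :: complex)"
proof (rule LIMSEQ_offset[where k = k], rule Lim_transform_eventually)
  have l: "(\<lambda>n. of_nat (n + k) / of_nat n :: complex) \<longlonglongrightarrow> 1"
  proof (rule Lim_transform_eventually)
    show "(\<lambda>n. 1 + of_nat k * inverse (of_nat n) :: complex) \<longlonglongrightarrow> 1"
      by (rule tendsto_eq_intros lim_inverse_n refl | simp)+
    show "\<forall>\<^sub>F n in sequentially. 1 + of_nat k * inverse (of_nat n) = (of_nat (n + k) / of_nat n :: complex)"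
      using eventually_gt_at_top[of 0] by eventually_elim (simp add: field_simps)
  qed
  show "(\<lambda>n. (- 1) ^ (k - 1) * (inverse (of_nat ((k + n) choose n) / of_nat (n ^ k)) *
      (of_nat (n + k) / of_nat n) ^ k)) \<longlonglongrightarrow> ((- 1) ^ (k - 1) * fact k :: complex)"
    using tendsto_mult[OF tendsto_inverse[OF fact_binomial_limit[of k]] tendsto_power[OF l, of k]]
    by (intro tendsto_mult_left) simp
  show "\<forall>\<^sub>F n in sequentially. (- 1) ^ (k - 1) * (inverse (of_nat ((k + n) choose n) / of_nat (n ^ k)) *
      (of_nat (n + k) / of_nat n) ^ k) =
    (\<Prod>m\<in>{1..n + k} - {k}. (of_nat m - of_nat k) / of_nat m) * (exp (of_nat k * of_real (ln (real (n + k)))) :: complex)"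
    using eventually_gt_at_top[of 0]
  proof eventually_elim
    case (elim n)
    have "exp (of_nat k * of_real (ln (real (n + k))) :: complex) = of_nat (n + k) ^ k"
      using elim by (simp add: exp_of_nat_mult exp_of_real)
    with elim show ?case
      unfolding prod_except_of_nat[OF assms] by (simp add: power_divide)
  qed
qed

section \<open>Assembling the quotient from the single-root limits\<close>

theorem theorem2p1:
  fixes p q k :: nat and a b r s :: "nat \<Rightarrow> complex"
  assumes "p \<ge> 1"
    and "a p \<noteq> 0" and "b q \<noteq> 0"
    and "a 0 = 1" and "b 0 = 1"
    and "a 1 = (if q = 0 then 0 else b 1)"
    and "lists_nonzero_roots (inv_polynomial a p) p r"
    and "lists_nonzero_roots (inv_polynomial b q) q s"
    and "k \<ge> 1" and "r 1 = of_nat k"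
    and "\<forall>i\<in>{2..p}. r i \<notin> of_nat ` {1..}"
    and "\<forall>i\<in>{1..q}. s i \<notin> of_nat ` {1..}"
  shows "(\<lambda>N. \<Prod>n\<in>{1..N} - {k}. inv_polynomial a p (of_nat n) / inv_polynomial b q (of_nat n))
    \<longlonglongrightarrow> (- 1) ^ (k - 1) * of_nat k powi (int p - int q) * fact (k - 1) *
      ((\<Prod>i=1..q. (of_nat k - s i) * Gamma (1 - s i)) /
       (\<Prod>i=2..p. (of_nat k - r i) * Gamma (1 - r i)))"
proof -
  \<comment> \<open>The exponential is the power of \<open>N\<close> with exponent \<open>r\<close>,
    which makes each single-root product converge.\<close>
  define F where "F = (\<lambda>r N. (\<Prod>n\<in>{1..N} - {k}. (of_nat n - r) / of_nat n) *
    exp (r * of_real (ln (real N))) :: complex)"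
  define K :: complex where "K = of_nat k"
  have K: "K \<noteq> 0" using assms(9) by (simp add: K_def)
  have sums: "(\<Sum>i=1..p. r i) = (\<Sum>i=1..q. s i)"
    using sum_roots[OF assms(4,2,7)] sum_roots[OF assms(5,3,8)] assms(1,6) by simp
  have F_prod: "(\<Prod>i=1..m. F (t i) N) = (\<Prod>n\<in>{1..N} - {k}. inv_polynomial c m (of_nat n)) *
      exp ((\<Sum>i=1..m. t i) * of_real (ln (real N)))"
    if "c 0 = 1" "c m \<noteq> 0" "lists_nonzero_roots (inv_polynomial c m) m t" for c t m N
  proof -
    have "(\<Prod>n\<in>{1..N} - {k}. inv_polynomial c m (of_nat n)) =
        (\<Prod>n\<in>{1..N} - {k}. \<Prod>i=1..m. (of_nat n - t i) / of_nat n)"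
      by (intro prod.cong refl inv_polynomial_factor[OF that]) auto
    also have "\<dots> = (\<Prod>i=1..m. \<Prod>n\<in>{1..N} - {k}. (of_nat n - t i) / of_nat n)"
      by (rule prod.swap)
    finally show ?thesis
      by (simp add: F_def prod.distrib exp_sum sum_distrib_right)
  qed
  have F_lim: "F t \<longlonglongrightarrow> K / ((K - t) * Gamma (1 - t))" if "t \<notin> of_nat ` {1..}" for t
  proof -
    have "t \<noteq> of_nat k" using that assms(9) by auto
    from tendsto_prod_except_rGamma[OF assms(9) this] show ?thesis
      by (simp add: F_def K_def rGamma_inverse_Gamma divide_inverse mult_ac)
  qed
  \<comment> \<open>These limits stand in the denominator for the roots \<open>s i\<close>. Since
    \<open>Gamma\<close> is 0 at its poles in this formalisation, \<open>1 - t\<close> has to be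
    kept away from the nonpositive integers.\<close>
  have nz: "K / ((K - t) * Gamma (1 - t)) \<noteq> 0" if "t \<notin> of_nat ` {1..}" for t
  proof -
    have "K - t \<noteq> 0" using that assms(9) by (auto simp: K_def)
    moreover have "1 - t \<notin> \<int>\<^sub>\<le>\<^sub>0"
    proof
      assume "1 - t \<in> \<int>\<^sub>\<le>\<^sub>0"
      then obtain n where "1 - t = - of_nat n" by (auto elim!: nonpos_Ints_cases')
      then have "t = of_nat (Suc n)" by (simp add: algebra_simps)
      with that show False by (metis atLeast_iff image_eqI le_add1 plus_1_eq_Suc)
    qed
    ultimately show ?thesis using K by (simp add: Gamma_eq_zero_iff)
  qed
  have p_split: "{1..p} = insert 1 {2..p}" using assms(1) by auto
  \<comment> \<open>The index 1 is split off because \<open>r 1 = k\<close> follows the binomial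
    limit instead of the Gamma limit.\<close>
  have "(\<lambda>N. F (r 1) N * (\<Prod>i=2..p. F (r i) N) / (\<Prod>i=1..q. F (s i) N))
    \<longlonglongrightarrow> ((- 1) ^ (k - 1) * fact k) * (\<Prod>i=2..p. K / ((K - r i) * Gamma (1 - r i))) /
      (\<Prod>i=1..q. K / ((K - s i) * Gamma (1 - s i)))"
  proof (intro tendsto_divide tendsto_mult tendsto_prod F_lim)
    show "F (r 1) \<longlonglongrightarrow> (- 1) ^ (k - 1) * fact k"
      using tendsto_prod_except_of_nat[OF assms(9)] unfolding F_def assms(10) .
    show "(\<Prod>i=1..q. K / ((K - s i) * Gamma (1 - s i))) \<noteq> 0"
      using assms(12) nz by (subst prod_zero_iff) blast+
  qed (use assms(11,12) in auto)
  also have "(\<lambda>N. F (r 1) N * (\<Prod>i=2..p. F (r i) N) / (\<Prod>i=1..q. F (s i) N)) =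
    (\<lambda>N. \<Prod>n\<in>{1..N} - {k}. inv_polynomial a p (of_nat n) / inv_polynomial b q (of_nat n))"
    (is "?L = ?R")
  proof
    fix N
    have "?L N = (\<Prod>i=1..p. F (r i) N) / (\<Prod>i=1..q. F (s i) N)"
      unfolding p_split by (subst prod.insert) auto
    \<comment> \<open>By \<open>sums\<close> the numerator and the denominator carry the same
      nonzero exponential, which cancels.\<close>
    also have "\<dots> = ?R N"
      unfolding F_prod[OF assms(4,2,7)] F_prod[OF assms(5,3,8)] sums
      by (simp add: prod_dividef)
    finally show "?L N = ?R N" .
  qed
  \<comment> \<open>The roots with \<open>i \<ge> 2\<close> supply \<open>p - 1\<close> powers of
    \<open>K\<close>, and \<open>fact k = k * fact (k - 1)\<close> supplies the remaining one, so
    the exponent becomes \<open>p - q\<close>.\<close>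
  also have "((- 1) ^ (k - 1) * fact k) * (\<Prod>i=2..p. K / ((K - r i) * Gamma (1 - r i))) /
      (\<Prod>i=1..q. K / ((K - s i) * Gamma (1 - s i))) =
    (- 1) ^ (k - 1) * (K * K ^ (p - 1) / K ^ q) * fact (k - 1) *
      ((\<Prod>i=1..q. (K - s i) * Gamma (1 - s i)) / (\<Prod>i=2..p. (K - r i) * Gamma (1 - r i)))"
    using fact_reduce[of k, where ?'a = complex] assms(9)
    by (simp add: prod_dividef K_def mult_ac)
  also have "K * K ^ (p - 1) / K ^ q = K powi (int p - int q)"
    using K assms(1) by (simp add: power_int_diff flip: power_Suc)
  finally show ?thesis by (simp add: K_def)
qed

end
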